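(* Let $H$ be a Hadamard matrix of order $n$ and let $r<n/16$. Suppose that for every three distinct rows $i,j,k$ of $H$, there exists a row $\ell\notin\{i,j,k\}$ with $T_{ijk\ell}\leqslant r$, and there is no row $x\notin\{i,j,k\}$ with $r<T_{ijkx}\leqslant 2r$. Then $n$ is a power of $2$.
   Context: A Hadamard matrix of order $n$ is an $n\times n$ matrix $H=(h_{uv})$ with entries in $\{-1,1\}$ such that $HH^\top=nI$. For four distinct rows $i,j,k,\ell$ of $H$, put $P_{ijk\ell}=\left|\sum_{r=1}^n h_{ir}h_{jr}h_{kr}h_{\ell r}\right|$; the type of the quadruple $\{i,j,k,\ell\}$ is $T_{ijk\ell}=\frac{n-P_{ijk\ell}}{8}$. *)

theory Defs
  imports "HOL-Analysis.Analysis"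
begin

(* The order of the matrix is CARD('n); rows and columns are indexed by 'n, and H $ u $ v is
   the entry in row u and column v. *)

definition hadamard_matrix :: "int ^ 'n ^ 'n \<Rightarrow> bool" where
  "hadamard_matrix H \<longleftrightarrow>
     (\<forall>u v. H $ u $ v \<in> {-1, 1}) \<and> H ** transpose H = mat (int CARD('n))"

definition profile :: "int ^ 'n ^ 'n \<Rightarrow> 'n \<Rightarrow> 'n \<Rightarrow> 'n \<Rightarrow> 'n \<Rightarrow> int" where
  "profile H i j k l = \<bar>\<Sum>c\<in>UNIV. H $ i $ c * H $ j $ c * H $ k $ c * H $ l $ c\<bar>"

(* Symmetric in i, j, k, l, hence a function of the set {i, j, k, l}; only meaningful for
   pairwise distinct rows. *)
definition quadruple_type :: "int ^ 'n ^ 'n \<Rightarrow> 'n \<Rightarrow> 'n \<Rightarrow> 'n \<Rightarrow> 'n \<Rightarrow> real" where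
  "quadruple_type H i j k l = (real CARD('n) - real_of_int (profile H i j k l)) / 8"

end

theory Submission
  imports Defs "HOL-Algebra.Sylow" "HOL-Algebra.Multiplicative_Group"
begin

text \<open>
  Extend the relation \<open>T \<le> r\<close> to all quadruples, degenerate ones included, by
  requiring the product of the four rows to have entry sum at least \<open>n - 8r\<close> in absolute
  value. Two related quadruples sharing two rows combine to a quadruple of type at most \<open>2r\<close>,
  and the gap hypothesis improves this to \<open>r\<close>. So every triple has a unique fourth row, and
  after fixing a row \<open>e\<close>, letting \<open>a + b\<close> be the fourth row of \<open>e, a, b\<close>
  turns the set of rows into an elementary abelian 2-group.
\<close>

section \<open>Finite groups of exponent 2\<close>

text \<open>An odd prime \<open>p\<close> dividing the order would yield a subgroup of order
  \<open>p\<close>. Its elements satisfy both \<open>x^2 = 1\<close> and \<open>x^p = 1\<close>,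
  hence \<open>x = 1\<close>, so it would be trivial.\<close>

lemma (in group) order_power_of_2_if_involutive:
  assumes fin: "finite (carrier G)"
    and inv: "\<And>x. x \<in> carrier G \<Longrightarrow> x \<otimes> x = \<one>"
  shows "\<exists>m::nat. order G = 2 ^ m"
proof -
  have "order G \<noteq> 0" "\<not> is_unit (2::nat)"
    using fin order_gt_0_iff_finite by simp_all
  then obtain a m where m: "order G = 2 ^ a * m" "\<not> 2 dvd m"
    using multiplicity_decompose' by metis
  have "m = 1"
  proof (rule ccontr)
    assume "m \<noteq> 1"
    then obtain p where p: "prime p" "p dvd m"
      using prime_factor_nat by blast
    then have "odd p" using m(2) by auto
    obtain k where "m = p * k" using p(2) by blast
    \<comment> \<open>Sylow's theorem with exponent 1 is Cauchy's theorem; the cofactor may still be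
      divisible by \<open>p\<close>.\<close>
    then have "order G = p ^ 1 * (2 ^ a * k)" using m(1) by simp
    from sylow_thm[OF p(1) is_group this fin]
    obtain K where K: "subgroup K G" "card K = p" by auto
    have "x = \<one>" if "x \<in> K" for x
    proof -
      have x: "x \<in> carrier G" using subgroup.mem_carrier[OF K(1) that] .
      have "x [^]\<^bsub>G\<lparr>carrier := K\<rparr>\<^esub> p = \<one>"
        using group.pow_order_eq_1[OF subgroup.subgroup_is_group[OF K(1) is_group], of x]
          that K(2) by (simp add: order_def)
      then have "x [^] p = \<one>"
        by (simp flip: nat_pow_consistent)
      moreover from \<open>odd p\<close> obtain q where "p = q + q + 1" by (metis oddE mult_2)
      then have "x [^] p = (x [^] q) \<otimes> (x [^] q) \<otimes> x"
        using x by (simp flip: nat_pow_mult)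
      ultimately show ?thesis using x inv by simp
    qed
    then have "K \<subseteq> {\<one>}" by blast
    then have "card K \<le> 1" using card_mono[of "{\<one>}" K] by simp
    then show False using K(2) prime_gt_1_nat[OF p(1)] by simp
  qed
  with m(1) have "order G = 2 ^ a" by simp
  then show ?thesis ..
qed

section \<open>Profiles of quadruples of rows\<close>

text \<open>For signs \<open>s\<close>, \<open>t\<close>, expanding
  \<open>(1 - s * u c) * (1 - t * v c) \<ge> 0\<close> gives
  \<open>s * u c + t * v c \<le> s * t * (u c * v c) + 1\<close>. Sum over \<open>c\<close> and let
  \<open>s\<close>, \<open>t\<close> be the signs of the two sums.\<close>

lemma abs_sum_sign_product:
  fixes u v :: "'a \<Rightarrow> int"
  assumes "\<And>c. c \<in> A \<Longrightarrow> u c \<in> {-1, 1}" "\<And>c. c \<in> A \<Longrightarrow> v c \<in> {-1, 1}"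
  shows "\<bar>\<Sum>c\<in>A. u c\<bar> + \<bar>\<Sum>c\<in>A. v c\<bar> \<le> \<bar>\<Sum>c\<in>A. u c * v c\<bar> + int (card A)"
proof -
  have key: "s * (\<Sum>c\<in>A. u c) + t * (\<Sum>c\<in>A. v c) \<le> s * t * (\<Sum>c\<in>A. u c * v c) + int (card A)"
    if "s \<in> {-1, 1}" "t \<in> {-1, 1}" for s t
  proof -
    have "(\<Sum>c\<in>A. s * u c + t * v c) \<le> (\<Sum>c\<in>A. s * t * (u c * v c) + 1)"
      using that assms by (intro sum_mono) fastforce
    then show ?thesis by (simp add: sum.distrib sum_distrib_left)
  qed
  show ?thesis
    using key[of 1 1] key[of 1 "-1"] key[of "-1" 1] key[of "-1" "-1"] by simp
qed

context
  fixes H :: "int ^ 'n ^ 'n"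
  assumes hadamard: "hadamard_matrix H"
begin

lemma entry: "H $ u $ v \<in> {-1, 1}"
  using hadamard by (auto simp: hadamard_matrix_def)

lemma entry_sq: "H $ u $ v * H $ u $ v = 1"
  using entry[of u v] by auto

lemma inner_rows: "(\<Sum>c\<in>UNIV. H $ i $ c * H $ j $ c) = (if i = j then int CARD('n) else 0)"
proof -
  have "(H ** transpose H) $ i $ j = mat (int CARD('n)) $ i $ j"
    using hadamard by (simp add: hadamard_matrix_def)
  then show ?thesis by (simp add: matrix_matrix_mult_def transpose_def mat_def)
qed

text \<open>Each equation moves another pair of positions to the front, where
  \<open>profile_degenerate\<close> can cancel equal rows.\<close>

lemma profile_perm:
  "profile H i j k l = profile H i k j l"
  "profile H i j k l = profile H i l j k"
  "profile H i j k l = profile H j k i l"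
  "profile H i j k l = profile H j l i k"
  "profile H i j k l = profile H k l i j"
  by (simp_all only: profile_def mult_ac)

lemma profile_degenerate: "profile H i i k l = (if k = l then int CARD('n) else 0)"
  by (simp add: profile_def entry_sq inner_rows)

lemma profile_not_distinct:
  assumes "\<not> distinct [i, j, k, l]"
  shows "profile H i j k l \<in> {0, int CARD('n)}"
proof -
  from assms consider "i = j" | "i = k" | "i = l" | "j = k" | "j = l" | "k = l"
    by auto
  then show ?thesis
  proof cases
    case 1 then show ?thesis by (simp add: profile_degenerate)
  next
    case 2 then show ?thesis using profile_perm(1)[of i j k l] by (simp add: profile_degenerate)
  next
    case 3 then show ?thesis using profile_perm(2)[of i j k l] by (simp add: profile_degenerate)
  next
    case 4 then show ?thesis using profile_perm(3)[of i j k l] by (simp add: profile_degenerate)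
  next
    case 5 then show ?thesis using profile_perm(4)[of i j k l] by (simp add: profile_degenerate)
  next
    case 6 then show ?thesis using profile_perm(5)[of i j k l] by (simp add: profile_degenerate)
  qed
qed

lemma profile_le: "profile H i j k l \<le> int CARD('n)"
proof -
  have "\<bar>H $ i $ c * H $ j $ c * H $ k $ c * H $ l $ c\<bar> = 1" for c
    using entry[of i c] entry[of j c] entry[of k c] entry[of l c] by auto
  then show ?thesis
    unfolding profile_def
    using sum_abs[of "\<lambda>c. H $ i $ c * H $ j $ c * H $ k $ c * H $ l $ c" UNIV] by simp
qed

text \<open>Multiplying the two row products cancels \<open>a\<close> and \<open>b\<close>, whose
  entries square to 1. In terms of types, this is the subadditivity
  \<open>T_cdef \<le> T_abcd + T_abef\<close>.\<close>

lemma profile_combine: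
  "profile H a b c d + profile H a b e f \<le> profile H c d e f + int CARD('n)"
proof -
  let ?p = "\<lambda>i j k l x. H $ i $ x * H $ j $ x * H $ k $ x * H $ l $ x"
  have pm: "?p i j k l x \<in> {-1, 1}" for i j k l x
    using entry[of i x] entry[of j x] entry[of k x] entry[of l x] by auto
  have "?p a b c d x * ?p a b e f x = ?p c d e f x" for x
  proof -
    have "?p a b c d x * ?p a b e f x
        = (H $ a $ x * H $ a $ x) * (H $ b $ x * H $ b $ x) * ?p c d e f x"
      by (simp only: mult_ac)
    then show ?thesis by (simp only: entry_sq mult_1)
  qed
  then have "(\<Sum>x\<in>UNIV. ?p a b c d x * ?p a b e f x) = (\<Sum>x\<in>UNIV. ?p c d e f x)"
    by (rule sum.cong[OF refl])
  then show ?thesis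
    using abs_sum_sign_product[of UNIV "?p a b c d" "?p a b e f", OF pm pm]
    by (simp only: profile_def)
qed

section \<open>Consequences of the gap between \<open>r\<close> and \<open>2 * r\<close>\<close>

context
  fixes r :: real
  assumes small: "r < real CARD('n) / 16"
    and fourth: "\<And>i j k. distinct [i, j, k] \<Longrightarrow> \<exists>l. l \<notin> {i, j, k} \<and> quadruple_type H i j k l \<le> r"
    and gap: "\<And>i j k l. distinct [i, j, k, l] \<Longrightarrow> quadruple_type H i j k l \<le> 2 * r
                \<Longrightarrow> quadruple_type H i j k l \<le> r"
    and nonneg: "0 \<le> r"
begin

abbreviation (input) related :: "'n \<Rightarrow> 'n \<Rightarrow> 'n \<Rightarrow> 'n \<Rightarrow> bool" where
  "related a b c d \<equiv> quadruple_type H a b c d \<le> r"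

lemma related_perm:
  "related i j k l \<longleftrightarrow> related i k j l"
  "related i j k l \<longleftrightarrow> related i l j k"
  "related i j k l \<longleftrightarrow> related j k i l"
  "related i j k l \<longleftrightarrow> related j l i k"
  "related i j k l \<longleftrightarrow> related k l i j"
  using profile_perm[of i j k l] by (simp_all add: quadruple_type_def)

lemma related_degenerate: "related i i k l \<longleftrightarrow> k = l"
  using nonneg small by (auto simp: quadruple_type_def profile_degenerate)

text \<open>The gap for degenerate quadruples: their type is 0 or \<open>n/8\<close>, and
  \<open>r < n/16\<close> puts \<open>n/8\<close> above \<open>2 * r\<close>.\<close>

lemma related_not_distinct:
  assumes "\<not> distinct [i, j, k, l]" "quadruple_type H i j k l \<le> 2 * r"
  shows "related i j k l"
proof -
  have "profile H i j k l \<noteq> 0"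
    using assms(2) small by (auto simp: quadruple_type_def)
  then have "profile H i j k l = int CARD('n)"
    using profile_not_distinct[OF assms(1)] by blast
  then show ?thesis using nonneg by (simp add: quadruple_type_def)
qed

lemma related_combine:
  assumes "related a b c d" "related a b e f"
  shows "related c d e f"
proof -
  have "quadruple_type H c d e f \<le> 2 * r"
  proof -
    have "real_of_int (profile H a b c d) + real_of_int (profile H a b e f)
        \<le> real_of_int (profile H c d e f) + real CARD('n)"
      using profile_combine[of a b c d e f] by linarith
    with assms show ?thesis by (simp add: quadruple_type_def)
  qed
  then show ?thesis using gap related_not_distinct by blast
qed

lemma related_exists: "\<exists>d. related a b c d"
proof -
  consider "distinct [a, b, c]" | "a = b" | "a = c" | "b = c" by auto
  then show ?thesis
  proof cases
    case 1 then show ?thesis using fourth by blast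
  next
    case 2 then show ?thesis using related_degenerate by blast
  next
    case 3 then show ?thesis using related_perm(1)[of a b a b] related_degenerate by auto
  next
    case 4 then show ?thesis using related_perm(3)[of a b b a] related_degenerate by auto
  qed
qed

text \<open>Cancelling \<open>a\<close> and \<open>b\<close> leaves the degenerate quadruple
  \<open>c, d, c, d'\<close>, which is related only if \<open>d = d'\<close>.\<close>

lemma related_unique:
  assumes "related a b c d" "related a b c d'"
  shows "d = d'"
proof -
  have "related c d c d'" using assms by (rule related_combine)
  then show ?thesis using related_perm(1)[of c d c d'] related_degenerate by simp
qed

section \<open>The group of rows\<close>

definition row_add :: "'n \<Rightarrow> 'n \<Rightarrow> 'n \<Rightarrow> 'n" where
  "row_add e a b = (SOME d. related e a b d)"

lemma row_add: "related e a b (row_add e a b)"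
  unfolding row_add_def using related_exists by (rule someI_ex)

lemma row_add_eqI: "related e a b d \<Longrightarrow> row_add e a b = d"
  using row_add related_unique by blast

text \<open>Both sides are the fourth row of \<open>a, b, c\<close>: the left one after cancelling
  the pair \<open>e\<close>, \<open>a + b\<close>, the right one after cancelling \<open>e\<close>,
  \<open>b + c\<close>.\<close>

lemma row_add_assoc: "row_add e (row_add e a b) c = row_add e a (row_add e b c)"
proof -
  let ?ab = "row_add e a b" and ?bc = "row_add e b c"
  have "related e ?ab a b"
    using row_add[of e a b] related_perm(2)[of e a b ?ab] by simp
  then have *: "related a b c (row_add e ?ab c)"
    using row_add by (rule related_combine)
  have "related e ?bc b c"
    using row_add[of e b c] related_perm(2)[of e b c ?bc] by simp
  moreover have "related e ?bc a (row_add e a ?bc)"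
    using row_add[of e a ?bc] related_perm(1)[of e a ?bc "row_add e a ?bc"] by simp
  ultimately have "related b c a (row_add e a ?bc)"
    by (rule related_combine)
  then have "related a b c (row_add e a ?bc)"
    using related_perm(3)[of a b c "row_add e a ?bc"] by simp
  with * show ?thesis by (rule related_unique)
qed

lemma card_rows_power_of_2: "\<exists>m::nat. CARD('n) = 2 ^ m"
proof -
  obtain e :: 'n where True by simp
  define G where "G = \<lparr>carrier = (UNIV :: 'n set), mult = row_add e, one = e\<rparr>"
  \<comment> \<open>The rows \<open>e, e, a, a\<close> multiply to the all-ones row, so this
    degenerate quadruple gives both laws; every row is its own inverse.\<close>
  have unit: "row_add e e a = a" and sq: "row_add e a a = e" for a
    using related_degenerate related_perm(3)[of e a a e] by (auto intro: row_add_eqI)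
  interpret group G
    by (rule groupI) (auto simp: G_def unit row_add_assoc intro: sq)
  have "\<exists>m::nat. order G = 2 ^ m"
    by (rule order_power_of_2_if_involutive) (simp_all add: G_def sq)
  then show ?thesis by (simp add: order_def G_def)
qed

end

end

theorem theorem3p4:
  fixes H :: "int ^ 'n ^ 'n" and r :: real
  assumes "hadamard_matrix H"
    and "r < real CARD('n) / 16"
    and "\<forall>i j k. distinct [i, j, k] \<longrightarrow>
           (\<exists>l. l \<notin> {i, j, k} \<and> quadruple_type H i j k l \<le> r) \<and>
           \<not> (\<exists>x. x \<notin> {i, j, k} \<and> r < quadruple_type H i j k x \<and> quadruple_type H i j k x \<le> 2 * r)"
  shows "\<exists>m::nat. CARD('n) = 2 ^ m"
proof (cases "CARD('n) \<le> 2")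
  \<comment> \<open>With at most two rows there are no triples, so the hypothesis says nothing and
    even \<open>r < 0\<close> is possible; but 1 and 2 are powers of 2.\<close>
  case True
  then have "CARD('n) = 1 \<or> CARD('n) = 2"
    using zero_less_card_finite[where 'a = 'n] by linarith
  then show ?thesis by (metis power_0 power_one_right)
next
  case False
  then obtain S :: "'n set" where "card S = 3"
    using obtain_subset_with_card_n[of 3 "UNIV :: 'n set"] by auto
  then obtain i j k :: 'n where "distinct [i, j, k]"
    by (auto simp: card_3_iff)
  then obtain l where "quadruple_type H i j k l \<le> r"
    using assms(3) by blast
  \<comment> \<open>A profile is at most \<open>n\<close>, so types are nonnegative, and some type
    is at most \<open>r\<close>.\<close>
  then have "0 \<le> r"
    using profile_le[OF assms(1), of i j k l] by (simp add: quadruple_type_def)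
  show ?thesis
  proof (rule card_rows_power_of_2[OF assms(1,2) _ _ \<open>0 \<le> r\<close>])
    fix i j k :: 'n
    assume "distinct [i, j, k]"
    then show "\<exists>l. l \<notin> {i, j, k} \<and> quadruple_type H i j k l \<le> r"
      using assms(3) by blast
  next
    fix i j k l :: 'n
    assume "distinct [i, j, k, l]" "quadruple_type H i j k l \<le> 2 * r"
    moreover from this(1) have "distinct [i, j, k]" "l \<notin> {i, j, k}" by auto
    ultimately show "quadruple_type H i j k l \<le> r"
      using assms(3) not_le by metis
  qed
qed

end
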